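(* The repeated selection mechanism satisfies feasibility: $x_i(\theta')\le v_i'$ for all $i\in V$ and all $\theta'\in\Theta$.
   Context: **Cost sharing problem.** Let $V$ be a finite set of nodes, $s\notin V$ a source, and $G=\langle V\cup\{s\},E\rangle$ a connected undirected graph in which each edge $(i,j)\in E$ has a cost $c_{(i,j)}\ge 0$. Each $i\in V$ has a private valuation $v_i\ge 0$. For $i\in V\cup\{s\}$ let $e_i$ be the set of edges adjacent to $i$, and let $\theta_i=(e_i,v_i)$ be the type of $i$ (the valuation of $s$ is null). Each node makes a report $\theta_i'=(e_i',v_i')$ with $e_i'\subseteq e_i$ and $v_i'\ge 0$; the source does not behave strategically. Let $\theta'=(\theta_i')_{i\in V\cup\{s\}}$ be the report profile, and $\Theta$ the space of all profiles. The induced graph is $G(\theta')=\langle V\cup\{s\},E(\theta')\rangle$ with $E(\theta')=\{(i,j)\in E : (i,j)\in e_i'\cap e_j'\}$. **Mechanism.** A cost sharing mechanism $(g,f,x)$ consists of $g:\Theta\to 2^V$ (selected nodes), $f:\Theta\to 2^E$ with $f(\theta')\subseteq E(\theta')$ (selected edges connecting the selected nodes), and $x:\Theta\to\mathbb{R}^{|V|}$ (cost shares), with $x_i(\theta')=0$ if $i\notin g(\theta')$. **Cost function.** For $S\subseteq V$, $C(S)$ is the weight of a minimum Steiner tree of $S\cup\{s\}$ in $G(\theta')$ (a minimum-weight tree containing these nodes, possibly using other nodes), with respect to the current edge costs; $C(S)=+\infty$ if no such tree exists. **Repeated selection mechanism (RSM).** Given $\theta'$, initialize $X^0=0$, $N^0=V$,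 $M^0=\emptyset$, $W^0=\emptyset$, $\mathcal{E}=\emptyset$. In stage $t=1,2,\dots$: minimize $X^t$ over nonempty $S^t\subseteq N^{t-1}$ subject to $X^t\ge X^{t-1}$, $X^t\cdot|S^t|=C(S^t)$, and $v_i'\ge X^t$ for all $i\in S^t$. - If there is a solution, let $S^t$ be a set attaining the minimum (no particular tie-breaking rule is specified) and set $x_i(\theta')=X^t$ for all $i\in S^t$. Let $\mathcal{E}^t$ be the edge set of the minimum Steiner tree of $S^t\cup\{s\}$. Update $W^t=\{i : v_i'<X^t\}$, $N^t=N^{t-1}\setminus(S^t\cup W^t)$, $M^t=M^{t-1}\cup S^t$, $\mathcal{E}=\mathcal{E}\cup\mathcal{E}^t$, and set $c_{(i,j)}=0$ for all $i\ne j$ in $M^t\cup\{s\}$ (meaning that the remaining nodes can use the edge $(i,j)$ without paying cost). - Otherwise set $g(\theta')=M^{t-1}$, $f(\theta')=\mathcal{E}$ and stop. Nodes not in $g(\theta')$ have $x_i(\theta')=0$. *)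

theory Defs
  imports Complex_Main "HOL-Library.FuncSet" "HOL-Library.Extended_Real"
begin

section \<open>Undirected graphs and trees\<close>

text \<open>Graphs are simple; the undirected edge $(i,j)$ is the two-element set $\{i,j\}$.\<close>

definition is_graph :: "'a set \<Rightarrow> 'a set set \<Rightarrow> bool" where
  "is_graph U F \<longleftrightarrow> F \<subseteq> {{i, j} | i j. i \<in> U \<and> j \<in> U \<and> i \<noteq> j}"

definition is_connected :: "'a set \<Rightarrow> 'a set set \<Rightarrow> bool" where
  "is_connected U F \<longleftrightarrow> (\<forall>i\<in>U. \<forall>j\<in>U. (i, j) \<in> {(a, b). {a, b} \<in> F}\<^sup>*)"

text \<open>A cycle is given by the list of its vertices, without repeating the first one at the end.\<close>

definition is_cycle :: "'a set set \<Rightarrow> 'a list \<Rightarrow> bool" where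
  "is_cycle F p \<longleftrightarrow> length p \<ge> 3 \<and> distinct p \<and>
     (\<forall>k<length p. {p ! k, p ! (Suc k mod length p)} \<in> F)"

definition is_tree :: "'a set \<Rightarrow> 'a set set \<Rightarrow> bool" where
  "is_tree U F \<longleftrightarrow> U \<noteq> {} \<and> is_graph U F \<and> is_connected U F \<and> (\<nexists>p. is_cycle F p)"


section \<open>The cost sharing problem\<close>

text \<open>A type, and likewise a report, is a pair of an edge set and a valuation.\<close>

type_synonym 'a agent_type = "'a set set \<times> real"
type_synonym 'a profile = "'a \<Rightarrow> 'a agent_type"

text \<open>The functions are only meaningful on \<open>\<Theta>\<close>: selected nodes, selected edges, cost shares.\<close>

type_synonym 'a mechanism =
  "('a profile \<Rightarrow> 'a set) \<times> ('a profile \<Rightarrow> 'a set set) \<times> ('a profile \<Rightarrow> 'a \<Rightarrow> real)"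

text \<open>
  State of the repeated selection mechanism after a stage: $X^t$, $N^t$, $M^t$, $W^t$,
  $\mathcal{E}$, the current edge costs, and the cost shares assigned so far.
\<close>

record 'a rsm_state =
  price :: real
  active :: "'a set"
  selected :: "'a set"
  withdrawn :: "'a set"
  tree_edges :: "'a set set"
  cost :: "'a set \<Rightarrow> real"
  share :: "'a \<Rightarrow> real"

locale cost_sharing_problem =
  fixes V :: "'a set" and s :: 'a and E :: "'a set set"
    and c :: "'a set \<Rightarrow> real" and v :: "'a \<Rightarrow> real"
  assumes finite_V: "finite V"
    and source: "s \<notin> V"
    and graph: "is_graph (V \<union> {s}) E"
    and connected: "is_connected (V \<union> {s}) E"
    and cost_nonneg: "\<And>e. e \<in> E \<Longrightarrow> 0 \<le> c e"
    and valuation_nonneg: "\<And>i. i \<in> V \<Longrightarrow> 0 \<le> v i"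
    and valuation_source: "v s = 0"
begin

definition true_type :: "'a profile" where
  "true_type i = ({e \<in> E. i \<in> e}, v i)"

text \<open>The source does not behave strategically, so it reports its true type.\<close>

definition reports :: "'a \<Rightarrow> 'a agent_type set" where
  "reports i = (if i = s then {true_type s} else {(e', v'). e' \<subseteq> fst (true_type i) \<and> 0 \<le> v'})"

definition \<Theta> :: "'a profile set" where
  "\<Theta> = (\<Pi>\<^sub>E i \<in> V \<union> {s}. reports i)"

definition induced_edges :: "'a profile \<Rightarrow> 'a set set" where
  "induced_edges \<theta> = {{i, j} | i j. {i, j} \<in> E \<and> {i, j} \<in> fst (\<theta> i) \<inter> fst (\<theta> j)}"

definition cost_sharing_mechanism :: "'a mechanism \<Rightarrow> bool" where
  "cost_sharing_mechanism = (\<lambda>(g, f, x). \<forall>\<theta>\<in>\<Theta>.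
     g \<theta> \<subseteq> V \<and> f \<theta> \<subseteq> induced_edges \<theta> \<and>
     (\<forall>i\<in>g \<theta>. (s, i) \<in> {(a, b). {a, b} \<in> f \<theta>}\<^sup>*) \<and>
     (\<forall>i\<in>V - g \<theta>. x \<theta> i = 0))"

definition feasible :: "'a mechanism \<Rightarrow> bool" where
  "feasible = (\<lambda>(g, f, x). \<forall>\<theta>\<in>\<Theta>. \<forall>i\<in>V. x \<theta> i \<le> snd (\<theta> i))"


subsection \<open>Minimum Steiner trees\<close>

definition steiner_tree :: "'a profile \<Rightarrow> 'a set \<Rightarrow> 'a set \<times> 'a set set \<Rightarrow> bool" where
  "steiner_tree \<theta> S = (\<lambda>(U, F).
     is_tree U F \<and> S \<union> {s} \<subseteq> U \<and> U \<subseteq> V \<union> {s} \<and> F \<subseteq> induced_edges \<theta>)"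

definition tree_weight :: "('a set \<Rightarrow> real) \<Rightarrow> 'a set \<times> 'a set set \<Rightarrow> real" where
  "tree_weight w = (\<lambda>(U, F). \<Sum>e\<in>F. w e)"

definition min_steiner_tree ::
  "'a profile \<Rightarrow> ('a set \<Rightarrow> real) \<Rightarrow> 'a set \<Rightarrow> 'a set \<times> 'a set set \<Rightarrow> bool" where
  "min_steiner_tree \<theta> w S = is_arg_min (tree_weight w) (steiner_tree \<theta> S)"

text \<open>
  There are only finitely many Steiner trees, so the infimum is a minimum; it is \<open>\<infinity>\<close> if there
  is no Steiner tree.
\<close>

definition C :: "'a profile \<Rightarrow> ('a set \<Rightarrow> real) \<Rightarrow> 'a set \<Rightarrow> ereal" where
  "C \<theta> w S = (INF T \<in> {T. steiner_tree \<theta> S T}. ereal (tree_weight w T))"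


subsection \<open>The repeated selection mechanism\<close>

definition init_state :: "'a rsm_state" where
  "init_state = \<lparr>price = 0, active = V, selected = {}, withdrawn = {}, tree_edges = {},
     cost = c, share = (\<lambda>_. 0)\<rparr>"

text \<open>The constraints of the minimisation problem for the pair $(X^t, S^t)$.\<close>

definition candidate :: "'a profile \<Rightarrow> 'a rsm_state \<Rightarrow> real \<times> 'a set \<Rightarrow> bool" where
  "candidate \<theta> \<sigma> = (\<lambda>(X, S). S \<noteq> {} \<and> S \<subseteq> active \<sigma> \<and> price \<sigma> \<le> X \<and>
     ereal (X * real (card S)) = C \<theta> (cost \<sigma>) S \<and> (\<forall>i\<in>S. X \<le> snd (\<theta> i)))"

definition solution :: "'a profile \<Rightarrow> 'a rsm_state \<Rightarrow> real \<times> 'a set \<Rightarrow> bool" where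
  "solution \<theta> \<sigma> = is_arg_min fst (candidate \<theta> \<sigma>)"

text \<open>
  The new costs are 0 on all pairs of distinct elements of $M^t \cup \{s\}$. Only edges of the
  induced graph can be part of a Steiner tree, so the values on other pairs are irrelevant.
\<close>

definition reset_cost :: "'a set \<Rightarrow> ('a set \<Rightarrow> real) \<Rightarrow> 'a set \<Rightarrow> real" where
  "reset_cost M w e =
     (if \<exists>i j. e = {i, j} \<and> i \<noteq> j \<and> i \<in> M \<union> {s} \<and> j \<in> M \<union> {s} then 0 else w e)"

text \<open>
  One successful stage. It is a relation because both the minimising \<open>S\<close> and the minimum
  Steiner tree \<open>(U, F)\<close> may be chosen freely among several.
\<close>

definition stage :: "'a profile \<Rightarrow> 'a rsm_state \<Rightarrow> 'a rsm_state \<Rightarrow> bool" where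
  "stage \<theta> \<sigma> \<sigma>' \<longleftrightarrow> (\<exists>X S U F W M.
     solution \<theta> \<sigma> (X, S) \<and> min_steiner_tree \<theta> (cost \<sigma>) S (U, F) \<and>
     W = {i \<in> V. snd (\<theta> i) < X} \<and> M = selected \<sigma> \<union> S \<and>
     \<sigma>' = \<lparr>price = X, active = active \<sigma> - (S \<union> W), selected = M, withdrawn = W,
        tree_edges = tree_edges \<sigma> \<union> F, cost = reset_cost M (cost \<sigma>),
        share = (\<lambda>i. if i \<in> S then X else share \<sigma> i)\<rparr>)"

definition outcome :: "'a profile \<Rightarrow> 'a set \<Rightarrow> 'a set set \<Rightarrow> ('a \<Rightarrow> real) \<Rightarrow> bool" where
  "outcome \<theta> N F y \<longleftrightarrow> (\<exists>\<sigma>. (stage \<theta>)\<^sup>*\<^sup>* init_state \<sigma> \<and> (\<nexists>XS. solution \<theta> \<sigma> XS) \<and>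
     N = selected \<sigma> \<and> F = tree_edges \<sigma> \<and>
     y = (\<lambda>i. if i \<in> selected \<sigma> then share \<sigma> i else 0))"

text \<open>Any rule for breaking ties, possibly depending on the report profile, is allowed.\<close>

definition repeated_selection_mechanism :: "'a mechanism \<Rightarrow> bool" where
  "repeated_selection_mechanism = (\<lambda>(g, f, x). \<forall>\<theta>\<in>\<Theta>. outcome \<theta> (g \<theta>) (f \<theta>) (x \<theta>))"


subsection \<open>Well-definedness\<close>

lemma finite_steiner_trees: "finite {T. steiner_tree \<theta> S T}"
proof (rule finite_subset)
  show "{T. steiner_tree \<theta> S T} \<subseteq> Pow (V \<union> {s}) \<times> Pow (Pow (V \<union> {s}))"
  proof clarify
    fix U F assume "steiner_tree \<theta> S (U, F)"
    then have U: "U \<subseteq> V \<union> {s}" and F: "F \<subseteq> {{i, j} | i j. i \<in> U \<and> j \<in> U \<and> i \<noteq> j}"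
      by (simp_all add: steiner_tree_def is_tree_def is_graph_def)
    from F have "F \<subseteq> Pow U" by blast
    with U show "U \<in> Pow (V \<union> {s}) \<and> F \<in> Pow (Pow (V \<union> {s}))" by blast
  qed
  show "finite (Pow (V \<union> {s}) \<times> Pow (Pow (V \<union> {s})))"
    using finite_V by simp
qed

lemma finite_candidates:
  assumes "active \<sigma> \<subseteq> V" shows "finite {XS. candidate \<theta> \<sigma> XS}"
proof (rule finite_subset)
  let ?h = "\<lambda>S. (real_of_ereal (C \<theta> (cost \<sigma>) S) / real (card S), S)"
  show "{XS. candidate \<theta> \<sigma> XS} \<subseteq> ?h ` Pow V"
  proof clarify
    fix X S assume cand: "candidate \<theta> \<sigma> (X, S)"
    then have S: "S \<in> Pow V" "S \<noteq> {}" using assms by (auto simp: candidate_def)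
    then have "card S \<noteq> 0" using finite_V by (auto simp: card_eq_0_iff dest: finite_subset)
    moreover have "C \<theta> (cost \<sigma>) S = ereal (X * real (card S))"
      using cand by (simp add: candidate_def)
    ultimately have "(X, S) = ?h S" by simp
    then show "(X, S) \<in> ?h ` Pow V" using S by blast
  qed
  show "finite (?h ` Pow V)" using finite_V by simp
qed

lemma ex_solution:
  assumes "active \<sigma> \<subseteq> V" "candidate \<theta> \<sigma> XS" shows "\<exists>XS. solution \<theta> \<sigma> XS"
proof -
  have "{XS. candidate \<theta> \<sigma> XS} \<noteq> {}" using assms(2) by blast
  from ex_is_arg_min_if_finite[OF finite_candidates[OF assms(1)] this, of fst]
  show ?thesis by (simp add: solution_def)
qed

lemma ex_min_steiner_tree:
  assumes "candidate \<theta> \<sigma> (X, S)" shows "\<exists>U F. min_steiner_tree \<theta> (cost \<sigma>) S (U, F)"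
proof -
  have "ereal (X * real (card S)) = C \<theta> (cost \<sigma>) S" using assms by (simp add: candidate_def)
  then have "C \<theta> (cost \<sigma>) S \<noteq> \<infinity>" by (metis PInfty_neq_ereal(1))
  then have "{T. steiner_tree \<theta> S T} \<noteq> {}"
    unfolding C_def by (metis Inf_empty image_empty top_ereal_def)
  from ex_is_arg_min_if_finite[OF finite_steiner_trees this, of "tree_weight (cost \<sigma>)"]
  show ?thesis by (auto simp: min_steiner_tree_def)
qed

lemma ex_run: "active \<sigma> \<subseteq> V \<Longrightarrow> \<exists>\<sigma>'. (stage \<theta>)\<^sup>*\<^sup>* \<sigma> \<sigma>' \<and> (\<nexists>XS. solution \<theta> \<sigma>' XS)"
proof (induction "card (active \<sigma>)" arbitrary: \<sigma> rule: less_induct)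
  case less
  show ?case
  proof (cases "\<exists>XS. solution \<theta> \<sigma> XS")
    case True
    then obtain X S where sol: "solution \<theta> \<sigma> (X, S)" by auto
    then have cand: "candidate \<theta> \<sigma> (X, S)" by (simp add: solution_def is_arg_min_def)
    obtain U F where UF: "min_steiner_tree \<theta> (cost \<sigma>) S (U, F)"
      using ex_min_steiner_tree[OF cand] by blast
    define W M \<sigma>' where "W = {i \<in> V. snd (\<theta> i) < X}" and "M = selected \<sigma> \<union> S" and
      \<sigma>': "\<sigma>' = \<lparr>price = X, active = active \<sigma> - (S \<union> W), selected = M, withdrawn = W,
        tree_edges = tree_edges \<sigma> \<union> F, cost = reset_cost M (cost \<sigma>),
        share = (\<lambda>i. if i \<in> S then X else share \<sigma> i)\<rparr>"
    then have st: "stage \<theta> \<sigma> \<sigma>'" unfolding stage_def using sol UF by blast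
    have act: "active \<sigma>' = active \<sigma> - (S \<union> W)" by (simp add: \<sigma>')
    have "active \<sigma>' \<subset> active \<sigma>" using cand act by (auto simp: candidate_def)
    moreover have "finite (active \<sigma>)" using less.prems finite_V finite_subset by blast
    ultimately have "card (active \<sigma>') < card (active \<sigma>)" by (rule psubset_card_mono[rotated])
    moreover have "active \<sigma>' \<subseteq> V" using act less.prems by auto
    ultimately obtain \<sigma>'' where "(stage \<theta>)\<^sup>*\<^sup>* \<sigma>' \<sigma>''" "\<nexists>XS. solution \<theta> \<sigma>'' XS"
      using less.hyps by blast
    then show ?thesis using st by (meson converse_rtranclp_into_rtranclp)
  qed blast
qed

lemma ex_repeated_selection_mechanism: "\<exists>m. repeated_selection_mechanism m"
proof -
  have "\<forall>\<theta>. \<exists>r. outcome \<theta> (fst r) (fst (snd r)) (snd (snd r))"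
  proof
    fix \<theta>
    obtain \<sigma> where "(stage \<theta>)\<^sup>*\<^sup>* init_state \<sigma>" "\<nexists>XS. solution \<theta> \<sigma> XS"
      using ex_run[of init_state \<theta>] by (auto simp: init_state_def)
    then have "outcome \<theta> (selected \<sigma>) (tree_edges \<sigma>)
      (\<lambda>i. if i \<in> selected \<sigma> then share \<sigma> i else 0)"
      unfolding outcome_def by blast
    then show "\<exists>r. outcome \<theta> (fst r) (fst (snd r)) (snd (snd r))"
      by (metis fst_conv snd_conv)
  qed
  then obtain r where "\<And>\<theta>. outcome \<theta> (fst (r \<theta>)) (fst (snd (r \<theta>))) (snd (snd (r \<theta>)))"
    by metis
  then have "repeated_selection_mechanism
    (\<lambda>\<theta>. fst (r \<theta>), \<lambda>\<theta>. fst (snd (r \<theta>)), \<lambda>\<theta>. snd (snd (r \<theta>)))"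
    by (simp add: repeated_selection_mechanism_def)
  then show ?thesis by blast
qed

lemma run_invariant:
  assumes "(stage \<theta>)\<^sup>*\<^sup>* init_state \<sigma>"
  shows "active \<sigma> \<subseteq> V \<and> selected \<sigma> \<subseteq> V \<and> tree_edges \<sigma> \<subseteq> induced_edges \<theta> \<and>
    (\<forall>i\<in>selected \<sigma>. (s, i) \<in> {(a, b). {a, b} \<in> tree_edges \<sigma>}\<^sup>*)"
  using assms
proof (induction rule: rtranclp_induct)
  case base
  show ?case by (simp add: init_state_def)
next
  case (step \<sigma> \<sigma>')
  from step.hyps(2) obtain X S U F W where
    sol: "solution \<theta> \<sigma> (X, S)" and mst: "min_steiner_tree \<theta> (cost \<sigma>) S (U, F)" and
    st: "active \<sigma>' = active \<sigma> - (S \<union> W)" "selected \<sigma>' = selected \<sigma> \<union> S"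
      "tree_edges \<sigma>' = tree_edges \<sigma> \<union> F"
    unfolding stage_def by (elim exE conjE) simp
  have S: "S \<subseteq> active \<sigma>" using sol by (simp add: solution_def is_arg_min_def candidate_def)
  have F: "is_connected U F" "S \<union> {s} \<subseteq> U" "F \<subseteq> induced_edges \<theta>"
    using mst by (auto simp: min_steiner_tree_def is_arg_min_def steiner_tree_def is_tree_def)
  have sub: "{(a, b). {a, b} \<in> A}\<^sup>* \<subseteq> {(a, b). {a, b} \<in> B}\<^sup>*" if "A \<subseteq> B" for A B :: "'a set set"
    using that by (intro rtrancl_mono) auto
  have "(s, i) \<in> {(a, b). {a, b} \<in> tree_edges \<sigma>'}\<^sup>*" if "i \<in> selected \<sigma>'" for i
  proof (cases "i \<in> S")
    case True
    then have "(s, i) \<in> {(a, b). {a, b} \<in> F}\<^sup>*" using F(1,2) by (auto simp: is_connected_def)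
    then show ?thesis using sub[of F "tree_edges \<sigma>'"] st(3) by blast
  next
    case False
    then have "(s, i) \<in> {(a, b). {a, b} \<in> tree_edges \<sigma>}\<^sup>*" using that st(2) step.IH by blast
    then show ?thesis using sub[of "tree_edges \<sigma>" "tree_edges \<sigma>'"] st(3) by blast
  qed
  then show ?case using step.IH S F(3) st by blast
qed

lemma repeated_selection_mechanism_is_mechanism:
  assumes "repeated_selection_mechanism m" shows "cost_sharing_mechanism m"
proof -
  obtain g f x where m: "m = (g, f, x)" by (cases m) auto
  have "g \<theta> \<subseteq> V \<and> f \<theta> \<subseteq> induced_edges \<theta> \<and>
     (\<forall>i\<in>g \<theta>. (s, i) \<in> {(a, b). {a, b} \<in> f \<theta>}\<^sup>*) \<and> (\<forall>i\<in>V - g \<theta>. x \<theta> i = 0)"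
    if "\<theta> \<in> \<Theta>" for \<theta>
  proof -
    have "outcome \<theta> (g \<theta>) (f \<theta>) (x \<theta>)"
      using assms that by (simp add: m repeated_selection_mechanism_def)
    then obtain \<sigma> where "(stage \<theta>)\<^sup>*\<^sup>* init_state \<sigma>" and out: "g \<theta> = selected \<sigma>"
      "f \<theta> = tree_edges \<sigma>" "x \<theta> = (\<lambda>i. if i \<in> selected \<sigma> then share \<sigma> i else 0)"
      unfolding outcome_def by blast
    from run_invariant[OF this(1)] show ?thesis by (simp add: out)
  qed
  then show ?thesis by (simp add: m cost_sharing_mechanism_def)
qed

end

end

theory Submission
  imports Defs
begin

text \<open>A node receives a price X only in a stage that selects it, and a set S is eligible at
  price X only if every member reports a valuation of at least X. Hence along any run, whatever sets
  and Steiner trees are chosen, selected nodes pay at most their report: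
  \<open>stage_share_le\<close> is the one-stage step, \<open>run_share_le\<close> the induction.
  Nodes never selected pay 0, which \<open>reported_valuation_nonneg\<close> bounds by their
  report.\<close>

context cost_sharing_problem
begin

lemma stage_share_le:
  assumes "stage \<theta> \<sigma> \<sigma>'" and "\<forall>i\<in>selected \<sigma>. share \<sigma> i \<le> snd (\<theta> i)"
  shows "\<forall>i\<in>selected \<sigma>'. share \<sigma>' i \<le> snd (\<theta> i)"
proof -
  from assms(1) obtain X S where sol: "solution \<theta> \<sigma> (X, S)"
    and st: "selected \<sigma>' = selected \<sigma> \<union> S" "share \<sigma>' = (\<lambda>i. if i \<in> S then X else share \<sigma> i)"
    unfolding stage_def by (elim exE conjE) simp
  \<comment> \<open>A minimiser is in particular a candidate, and this bound is one of the
    constraints on candidates.\<close>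
  have "\<forall>i\<in>S. X \<le> snd (\<theta> i)"
    using sol by (simp add: solution_def is_arg_min_def candidate_def)
  then show ?thesis using st assms(2) by auto
qed

text \<open>Restricting the invariant to \<open>selected\<close> makes it vacuous at
  \<open>init_state\<close>, so it holds for arbitrary \<theta>; membership in \<Theta> matters only
  for the unselected nodes.\<close>

lemma run_share_le:
  assumes "(stage \<theta>)\<^sup>*\<^sup>* init_state \<sigma>"
  shows "\<forall>i\<in>selected \<sigma>. share \<sigma> i \<le> snd (\<theta> i)"
  using assms
proof (induction rule: rtranclp_induct)
  case base
  show ?case by (simp add: init_state_def)
next
  case (step \<sigma> \<sigma>')
  then show ?case using stage_share_le by blast
qed

lemma reported_valuation_nonneg:
  assumes "\<theta> \<in> \<Theta>" and "i \<in> V"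
  shows "0 \<le> snd (\<theta> i)"
proof -
  have "\<theta> i \<in> reports i" using assms unfolding \<Theta>_def by blast
  \<comment> \<open>Since s is not in V, i falls under the branch of \<open>reports\<close> that
    demands a nonnegative valuation.\<close>
  then show ?thesis using assms(2) source by (auto simp: reports_def split: if_splits)
qed

lemma repeated_selection_mechanism_feasible:
  assumes "repeated_selection_mechanism m"
  shows "feasible m"
proof -
  obtain g f x where m: "m = (g, f, x)" by (cases m) auto
  have "x \<theta> i \<le> snd (\<theta> i)" if \<theta>: "\<theta> \<in> \<Theta>" and i: "i \<in> V" for \<theta> i
  proof -
    have "outcome \<theta> (g \<theta>) (f \<theta>) (x \<theta>)"
      using assms \<theta> by (simp add: m repeated_selection_mechanism_def)
    then obtain \<sigma> where run: "(stage \<theta>)\<^sup>*\<^sup>* init_state \<sigma>"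
      and x: "x \<theta> = (\<lambda>i. if i \<in> selected \<sigma> then share \<sigma> i else 0)"
      unfolding outcome_def by blast
    \<comment> \<open>The two facts settle the two branches of the conditional in \<open>x\<close>:
      selected and unselected nodes.\<close>
    show ?thesis using run_share_le[OF run] reported_valuation_nonneg[OF \<theta> i] by (simp add: x)
  qed
  then show ?thesis by (simp add: m feasible_def)
qed

end

theorem theorem6p4:
  fixes V :: "'a set" and s :: 'a and E :: "'a set set"
    and c :: "'a set \<Rightarrow> real" and v :: "'a \<Rightarrow> real"
    and m :: "'a mechanism"
  assumes "cost_sharing_problem V s E c v"
    and "cost_sharing_problem.repeated_selection_mechanism V s E c v m"
  shows "cost_sharing_problem.feasible V s E v m"
  using assms by (rule cost_sharing_problem.repeated_selection_mechanism_feasible)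

end
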